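(* Let $k,t$ be integers with $2\leq k<t$, and let $G$ be the complete bipartite graph with classes $U=\{u_1,\ldots,u_t\}$ and $V=\{v_1,\ldots,v_k\}$. Then $pc_k(G)=t$ and $pvc_k(G)=2$.
   Context: All graphs are simple, finite and undirected. Colorings of edges or vertices are arbitrary (not required to be proper). A set of internally vertex-disjoint paths is called disjoint. A path in an edge-colored graph is a proper path if any two adjacent edges of the path differ in color. An edge-colored graph is proper $k$-connected if any two distinct vertices are connected by $k$ (distinct) disjoint proper paths. For a $k$-connected graph $G$, $pc_k(G)$ is the smallest number of colors required on the edges to make $G$ proper $k$-connected. A path in a vertex-colored graph is a vertex-proper path if any two adjacent internal vertices of the path differ in color (the end-vertices are not internal). A vertex-colored graph is proper vertex $k$-connected if any two distinct vertices are connected by $k$ (distinct) disjoint vertex-proper paths. For a $k$-connected graph $G$, $pvc_k(G)$ is the smallest number of colors required on the vertices to make $G$ proper vertex $k$-connected. *)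

theory Defs
  imports Main
begin

record 'a ugraph =
  verts :: "'a set"
  edges :: "'a set set"

definition simple_graph :: "'a ugraph \<Rightarrow> bool" where
  "simple_graph G \<longleftrightarrow> finite (verts G) \<and>
     (\<forall>e\<in>edges G. \<exists>x\<in>verts G. \<exists>y\<in>verts G. x \<noteq> y \<and> e = {x, y})"

definition complete_bipartite :: "'a set \<Rightarrow> 'a set \<Rightarrow> 'a ugraph" where
  "complete_bipartite U V = \<lparr>verts = U \<union> V, edges = {{u, v} | u v. u \<in> U \<and> v \<in> V}\<rparr>"

lemma simple_graph_complete_bipartite:
  assumes "finite U" "finite V" "U \<inter> V = {}"
  shows "simple_graph (complete_bipartite U V)"
proof -
  have "\<exists>x\<in>U \<union> V. \<exists>y\<in>U \<union> V. x \<noteq> y \<and> {u, v} = {x, y}" if "u \<in> U" "v \<in> V" for u v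
  proof (intro bexI conjI)
    show "u \<noteq> v" using that assms(3) by blast
  qed (use that in simp_all)
  then have "\<forall>e\<in>{{u, v} | u v. u \<in> U \<and> v \<in> V}. \<exists>x\<in>U \<union> V. \<exists>y\<in>U \<union> V. x \<noteq> y \<and> e = {x, y}"
    by blast
  with assms(1,2) show ?thesis
    by (simp only: simple_graph_def complete_bipartite_def ugraph.simps finite_Un simp_thms)
qed

text \<open>A path is given by the list of its vertices, read from one end to the other.\<close>

fun path_edges :: "'a list \<Rightarrow> 'a set list" where
  "path_edges (x # y # zs) = {x, y} # path_edges (y # zs)"
| "path_edges _ = []"

definition inner_verts :: "'a list \<Rightarrow> 'a list" where
  "inner_verts p = butlast (tl p)"

definition is_path :: "'a ugraph \<Rightarrow> 'a \<Rightarrow> 'a list \<Rightarrow> 'a \<Rightarrow> bool" where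
  "is_path G x p y \<longleftrightarrow> p \<noteq> [] \<and> hd p = x \<and> last p = y \<and> distinct p \<and>
     set p \<subseteq> verts G \<and> set (path_edges p) \<subseteq> edges G"

definition internally_disjoint :: "'a list \<Rightarrow> 'a list \<Rightarrow> bool" where
  "internally_disjoint p q \<longleftrightarrow>
     set (inner_verts p) \<inter> set q = {} \<and> set p \<inter> set (inner_verts q) = {}"

text \<open>
  Since the paths are collected in a set, they are distinct; in particular an edge
  between the two vertices, a path without inner vertices, is counted only once.
\<close>

definition connected_by :: "'a ugraph \<Rightarrow> ('a list \<Rightarrow> bool) \<Rightarrow> nat \<Rightarrow> 'a \<Rightarrow> 'a \<Rightarrow> bool" where
  "connected_by G Q k x y \<longleftrightarrow> (\<exists>P. finite P \<and> card P = k \<and>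
     (\<forall>p\<in>P. is_path G x p y \<and> Q p) \<and> pairwise internally_disjoint P)"

definition proper_path :: "('a set \<Rightarrow> nat) \<Rightarrow> 'a list \<Rightarrow> bool" where
  "proper_path c p \<longleftrightarrow> successively (\<lambda>e f. c e \<noteq> c f) (path_edges p)"

definition vertex_proper_path :: "('a \<Rightarrow> nat) \<Rightarrow> 'a list \<Rightarrow> bool" where
  "vertex_proper_path c p \<longleftrightarrow> successively (\<lambda>x y. c x \<noteq> c y) (inner_verts p)"

definition proper_connected :: "nat \<Rightarrow> 'a ugraph \<Rightarrow> ('a set \<Rightarrow> nat) \<Rightarrow> bool" where
  "proper_connected k G c \<longleftrightarrow>
     (\<forall>x\<in>verts G. \<forall>y\<in>verts G. x \<noteq> y \<longrightarrow> connected_by G (proper_path c) k x y)"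

definition proper_vertex_connected :: "nat \<Rightarrow> 'a ugraph \<Rightarrow> ('a \<Rightarrow> nat) \<Rightarrow> bool" where
  "proper_vertex_connected k G c \<longleftrightarrow>
     (\<forall>x\<in>verts G. \<forall>y\<in>verts G. x \<noteq> y \<longrightarrow> connected_by G (vertex_proper_path c) k x y)"

text \<open>
  A colouring with \<open>n\<close> colours takes values in \<open>{..<n}\<close>. For finite \<open>k\<close>-connected graphs,
  the intended arguments, both minima below are taken over a nonempty set: colour the
  edges, respectively the vertices, with pairwise different colours.
\<close>

definition pc :: "nat \<Rightarrow> 'a ugraph \<Rightarrow> nat" where
  "pc k G = (LEAST n. \<exists>c. c ` edges G \<subseteq> {..<n} \<and> proper_connected k G c)"

definition pvc :: "nat \<Rightarrow> 'a ugraph \<Rightarrow> nat" where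
  "pvc k G = (LEAST n. \<exists>c. c ` verts G \<subseteq> {..<n} \<and> proper_vertex_connected k G c)"

end

theory Submission
  imports Defs
begin

text \<open>
  Two vertices of \<open>U\<close> can only be joined by \<open>k = |V|\<close> disjoint paths if each path
  has exactly one inner vertex, so that all paths of length two between them are proper.
  Hence the \<open>t\<close> edges at any vertex of \<open>V\<close> have distinct colours.
  Conversely, the Latin square colouring \<open>u\<^sub>i v\<^sub>j \<mapsto> i + j mod t\<close> is a proper
  edge colouring, which makes every path proper, so \<open>k\<close>-connectedness suffices.
  Likewise the bipartition makes every path vertex-proper, while one colour does
  not suffice because the second path between adjacent vertices has two adjacent
  inner vertices.
\<close>

section \<open>Edges of complete bipartite graphs and families of disjoint paths\<close>

lemma complete_bipartite_commute: "complete_bipartite U V = complete_bipartite V U"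
  unfolding complete_bipartite_def by (auto simp: insert_commute)

lemma verts_complete_bipartite [simp]: "verts (complete_bipartite U V) = U \<union> V"
  by (simp add: complete_bipartite_def)

lemma edge_complete_bipartite_iff [simp]:
  "{x, y} \<in> edges (complete_bipartite U V) \<longleftrightarrow> x \<in> U \<and> y \<in> V \<or> x \<in> V \<and> y \<in> U"
  by (auto simp: complete_bipartite_def doubleton_eq_iff)

text \<open>Separates connectivity from colours: disjoint paths are found for the trivial predicate
  first, which is strengthened once every path of the graph is known to be proper.\<close>

lemma connected_by_mono:
  assumes "connected_by G Q k x y" and "\<And>p. is_path G x p y \<Longrightarrow> Q p \<Longrightarrow> R p"
  shows "connected_by G R k x y"
proof -
  obtain P where "finite P" "card P = k" "pairwise internally_disjoint P"
    "\<forall>p\<in>P. is_path G x p y \<and> Q p"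
    using assms(1) unfolding connected_by_def by blast
  then show ?thesis
    unfolding connected_by_def using assms(2) by (intro exI[of _ P]) simp
qed

lemma connected_by_if_le_card:
  assumes "finite P" and "k \<le> card P" and "\<And>p. p \<in> P \<Longrightarrow> is_path G x p y"
    and "pairwise internally_disjoint P"
  shows "connected_by G (\<lambda>_. True) k x y"
proof -
  obtain P' where "P' \<subseteq> P" "card P' = k" "finite P'"
    using assms(2) by (meson obtain_subset_with_card_n)
  moreover from this have "pairwise internally_disjoint P'"
    using assms(4) pairwise_subset by blast
  ultimately show ?thesis
    unfolding connected_by_def using assms(3) by (intro exI[of _ P']) auto
qed

section \<open>Disjoint paths in complete bipartite graphs\<close>

lemma complete_bipartite_connected_same_side:
  assumes "finite V" and "U \<inter> V = {}" and "k \<le> card V" and "x \<in> U" "y \<in> U" "x \<noteq> y"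
  shows "connected_by (complete_bipartite U V) (\<lambda>_. True) k x y"
proof (rule connected_by_if_le_card[where P = "(\<lambda>v. [x, v, y]) ` V"])
  show "k \<le> card ((\<lambda>v. [x, v, y]) ` V)"
    using assms by (subst card_image) (auto simp: inj_on_def)
  show "is_path (complete_bipartite U V) x p y" if "p \<in> (\<lambda>v. [x, v, y]) ` V" for p
    using that assms by (auto simp: is_path_def)
  show "pairwise internally_disjoint ((\<lambda>v. [x, v, y]) ` V)"
    using assms by (auto simp: pairwise_def internally_disjoint_def inner_verts_def)
qed (use assms in simp)

text \<open>The edge itself counts as one path; the others have length three and are indexed by
  \<open>S\<close>. Two injections \<open>a\<close> and \<open>b\<close> are allowed so that either
  of them can be the identity, depending on which end lies on the smaller side.\<close>

lemma complete_bipartite_connected_opposite_sides: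
  assumes "finite S" and "U \<inter> V = {}" and "x \<in> U" "y \<in> V"
    and "inj_on a S" "a ` S \<subseteq> V - {y}" and "inj_on b S" "b ` S \<subseteq> U - {x}"
    and "k \<le> Suc (card S)"
  shows "connected_by (complete_bipartite U V) (\<lambda>_. True) k x y"
proof (rule connected_by_if_le_card[where P = "insert [x, y] ((\<lambda>s. [x, a s, b s, y]) ` S)"])
  have "inj_on (\<lambda>s. [x, a s, b s, y]) S"
    using assms(5) by (auto simp: inj_on_def)
  moreover have "[x, y] \<notin> (\<lambda>s. [x, a s, b s, y]) ` S"
    by auto
  ultimately show "k \<le> card (insert [x, y] ((\<lambda>s. [x, a s, b s, y]) ` S))"
    using assms(1,9) by (simp add: card_image)
  have sides: "a s \<in> V" "a s \<noteq> y" "b s \<in> U" "b s \<noteq> x" if "s \<in> S" for s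
    using that assms(6,8) by auto
  have disj: "a s \<noteq> b s'" "a s \<noteq> x" "b s \<noteq> y" if "s \<in> S" "s' \<in> S" for s s'
    using sides(1)[of s] sides(3)[of s] sides(3)[of s'] that assms(2-4) by auto
  have "x \<noteq> y"
    using assms(2-4) by blast
  show "is_path (complete_bipartite U V) x p y"
    if p: "p \<in> insert [x, y] ((\<lambda>s. [x, a s, b s, y]) ` S)" for p
  proof -
    consider "p = [x, y]" | s where "s \<in> S" "p = [x, a s, b s, y]"
      using p by auto
    then show ?thesis
    proof cases
      case 1
      then show ?thesis using assms(3,4) \<open>x \<noteq> y\<close> by (simp add: is_path_def)
    next
      case 2
      then show ?thesis
        using assms(3,4) sides[of s] disj[of s s] \<open>x \<noteq> y\<close> by (simp add: is_path_def)
    qed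
  qed
  have "internally_disjoint [x, a s, b s, y] [x, a s', b s', y]"
    if "s \<in> S" "s' \<in> S" "s \<noteq> s'" for s s'
  proof -
    have "a s \<noteq> a s'" "b s \<noteq> b s'"
      using that assms(5,7) by (auto dest: inj_onD)
    then show ?thesis
      using that sides[of s] sides[of s'] disj[of s s'] disj[of s' s]
      by (simp add: internally_disjoint_def inner_verts_def)
  qed
  moreover have "internally_disjoint [x, y] [x, a s, b s, y]"
    "internally_disjoint [x, a s, b s, y] [x, y]" if "s \<in> S" for s
    using sides[of s] disj[of s s] that
    by (simp_all add: internally_disjoint_def inner_verts_def)
  ultimately show "pairwise internally_disjoint (insert [x, y] ((\<lambda>s. [x, a s, b s, y]) ` S))"
    unfolding pairwise_insert by (auto simp: pairwise_def)
qed (use assms(1) in simp)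

lemma complete_bipartite_connected:
  assumes "finite U" "finite V" "U \<inter> V = {}" and "card V \<le> card U"
    and "x \<in> U \<union> V" "y \<in> U \<union> V" "x \<noteq> y"
  shows "connected_by (complete_bipartite U V) (\<lambda>_. True) (card V) x y"
proof -
  \<comment> \<open>Matches the smaller side without one end to the larger side without the other,
    which yields \<open>card V - 1\<close> paths of length three.\<close>
  have *: "\<exists>g. inj_on g (V - {v}) \<and> g ` (V - {v}) \<subseteq> U - {u}" if "u \<in> U" "v \<in> V" for u v
  proof -
    have "card (V - {v}) \<le> card (U - {u})"
      using that assms(1,2,4) by simp
    then show ?thesis
      using assms(1,2) card_le_inj[of "V - {v}" "U - {u}"] by blast
  qed
  have card: "card V \<le> Suc (card (V - {v}))" for v
    using assms(2) by (cases "v \<in> V") (auto simp: card_Diff_singleton)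
  consider "x \<in> U" "y \<in> U" | "x \<in> V" "y \<in> V" | "x \<in> U" "y \<in> V" | "x \<in> V" "y \<in> U"
    using assms(5,6) by blast
  then show ?thesis
  proof cases
    case 1
    then show ?thesis using assms by (intro complete_bipartite_connected_same_side) auto
  next
    case 2
    then show ?thesis
      using assms complete_bipartite_connected_same_side[of U V "card V" x y]
      by (simp add: complete_bipartite_commute[of U] Int_commute)
  next
    case 3
    then obtain g where "inj_on g (V - {y})" "g ` (V - {y}) \<subseteq> U - {x}"
      using * by blast
    with 3 card show ?thesis
      using assms complete_bipartite_connected_opposite_sides
          [of "V - {y}" U V x y "\<lambda>v. v" g "card V"]
      by simp
  next
    case 4
    then obtain g where "inj_on g (V - {x})" "g ` (V - {x}) \<subseteq> U - {y}"
      using * by blast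
    with 4 card show ?thesis
      using assms complete_bipartite_connected_opposite_sides
          [of "V - {x}" V U x y g "\<lambda>v. v" "card V"]
      by (simp add: complete_bipartite_commute[of U] Int_commute)
  qed
qed

section \<open>Proper colourings make every path proper\<close>

lemma proper_path_if_proper_edge_coloring:
  assumes "\<And>x y z. {x, y} \<in> E \<Longrightarrow> {y, z} \<in> E \<Longrightarrow> x \<noteq> z \<Longrightarrow> c {x, y} \<noteq> c {y, z}"
    and "distinct p" and "set (path_edges p) \<subseteq> E"
  shows "proper_path c p"
  using assms(2,3)
proof (induction p rule: path_edges.induct)
  case (1 x y zs)
  then show ?case
    using assms(1) by (cases zs) (auto simp: proper_path_def)
qed (simp_all add: proper_path_def)

lemma successively_butlast: "successively R xs \<Longrightarrow> successively R (butlast xs)"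
  by (metis append_butlast_last_id butlast.simps(1) successively_append_iff)

lemma successively_tl: "successively R xs \<Longrightarrow> successively R (tl xs)"
  by (cases xs) (auto simp: successively_Cons)

lemma vertex_proper_path_if_proper_coloring:
  assumes "\<And>x y. {x, y} \<in> E \<Longrightarrow> c x \<noteq> c y" and "set (path_edges p) \<subseteq> E"
  shows "vertex_proper_path c p"
proof -
  have "successively (\<lambda>x y. c x \<noteq> c y) p"
    using assms(2) by (induction p rule: path_edges.induct) (auto simp: assms(1))
  then show ?thesis
    by (simp add: vertex_proper_path_def inner_verts_def successively_butlast successively_tl)
qed

section \<open>The number of edge colours\<close>

text \<open>The second vertices of the \<open>card V\<close> disjoint paths from \<open>u\<close> to
  \<open>u'\<close> are distinct elements of \<open>V\<close>, so they exhaust \<open>V\<close>. A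
  path with a further vertex in \<open>V\<close> would thus hit the second vertex of another path.
  Hence the path through \<open>v\<close> is \<open>[u, v, u']\<close>, and its two edges differ in
  colour.\<close>

lemma proper_connected_complete_bipartite_inj:
  assumes "finite V" "U \<inter> V = {}"
    and conn: "proper_connected (card V) (complete_bipartite U V) c" and "v \<in> V"
  shows "inj_on (\<lambda>u. c {u, v}) U"
proof (rule inj_onI, rule ccontr)
  fix u u' assume uu': "u \<in> U" "u' \<in> U" "c {u, v} = c {u', v}" "u \<noteq> u'"
  let ?G = "complete_bipartite U V"
  from conn uu' obtain P where P: "finite P" "card P = card V"
    "\<And>p. p \<in> P \<Longrightarrow> is_path ?G u p u'" "\<And>p. p \<in> P \<Longrightarrow> proper_path c p"
    "pairwise internally_disjoint P"
    unfolding proper_connected_def connected_by_def by (metis UnI1 verts_complete_bipartite)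
  have shape: "\<exists>x y zs. p = u # x # y # zs \<and> x \<in> V \<and> y \<in> U" if "p \<in> P" for p
    using P(3)[OF that] uu' assms(2)
    by (cases p rule: path_edges.cases; cases "tl (tl p)") (auto simp: is_path_def)
  have snd: "p ! 1 \<in> set (inner_verts p) \<and> p ! 1 \<in> V" if "p \<in> P" for p
    using shape[OF that] by (auto simp: inner_verts_def)
  \<comment> \<open>The second vertex of \<open>q\<close> is an inner vertex of \<open>q\<close>, so
    no other path of the family may contain it.\<close>
  have meet: "p = q" if "p \<in> P" "q \<in> P" "q ! 1 \<in> set p" for p q
    using that P(5) snd[of q] unfolding pairwise_def internally_disjoint_def by blast
  have inner: "p ! 1 \<in> set p" if "p \<in> P" for p
    using shape[OF that] by auto
  have "inj_on (\<lambda>p. p ! 1) P"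
  proof (rule inj_onI)
    fix p q assume "p \<in> P" "q \<in> P" "p ! 1 = q ! 1"
    then show "p = q"
      using meet[of p q] inner[of p] by argo
  qed
  then have onto: "(\<lambda>p. p ! 1) ` P = V"
    using P(2) snd assms(1) by (intro card_subset_eq) (auto simp: card_image)
  then obtain p where p: "p \<in> P" "p ! 1 = v"
    using \<open>v \<in> V\<close> by blast
  obtain w zs where w: "p = u # v # w # zs" "w \<in> U"
    using shape[OF p(1)] p(2) by auto
  show False
  proof (cases zs)
    case Nil
    then have "w = u'" using P(3)[OF p(1)] w by (simp add: is_path_def)
    then show False
      using P(4)[OF p(1)] w Nil uu'(3) by (simp add: proper_path_def insert_commute)
  next
    case (Cons z zs')
    have z: "z \<in> V" "z \<noteq> v" "z \<in> set p"
      using P(3)[OF p(1)] w Cons assms(2) by (auto simp: is_path_def)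
    \<comment> \<open>Since \<open>p ! 1 = v\<close> and \<open>z\<close> differs from
      \<open>v\<close>, this \<open>q\<close> is not \<open>p\<close>, yet its second vertex lies on
      \<open>p\<close>.\<close>
    then obtain q where "q \<in> P" "q ! 1 = z"
      using onto by blast
    then show False
      using meet[of p q] p z by auto
  qed
qed

lemma pc_complete_bipartite:
  assumes "finite U" "finite V" "U \<inter> V = {}" "V \<noteq> {}" "card V \<le> card U"
  shows "pc (card V) (complete_bipartite U V) = card U"
  unfolding pc_def
proof (rule Least_equality)
  let ?G = "complete_bipartite U V" and ?t = "card U"
  have t: "0 < ?t"
    using assms card_gt_0_iff[of V] by linarith
  obtain f where f: "inj_on f U" "f ` U \<subseteq> {..<?t}"
    using card_le_inj[of U "{..<?t}"] assms(1) by auto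
  obtain g where g: "inj_on g V" "g ` V \<subseteq> {..<?t}"
    using card_le_inj[of V "{..<?t}"] assms by auto
  define h where "h x = (if x \<in> U then f x else g x)" for x
  \<comment> \<open>Summing over the edge as a set avoids choosing an order of its ends; on an edge
    this is the Latin square entry.\<close>
  define c where "c e = sum h e mod ?t" for e
  have c: "c {x, y} = (h x + h y) mod ?t" if "{x, y} \<in> edges ?G" for x y
  proof -
    have "x \<noteq> y" using that assms(3) by auto
    then show ?thesis by (simp add: c_def)
  qed
  have cancel: "a = b" if eq: "(m + a) mod ?t = (m + b) mod ?t" and "a < ?t" "b < ?t" for a b m
  proof -
    obtain q r where "a + ?t * q = b + ?t * r"
      using eq by (auto simp: nat_mod_eq_iff)
    then have "(a + ?t * q) mod ?t = (b + ?t * r) mod ?t"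
      by simp
    then show ?thesis
      using that(2,3) by simp
  qed
  have proper: "c {x, y} \<noteq> c {y, z}"
    if "{x, y} \<in> edges ?G" "{y, z} \<in> edges ?G" "x \<noteq> z" for x y z
  proof
    assume "c {x, y} = c {y, z}"
    then have "(h y + h x) mod ?t = (h y + h z) mod ?t"
      using that c by (simp add: add.commute)
    moreover have "h x < ?t" "h z < ?t"
      using that f(2) g(2) by (auto simp: h_def)
    ultimately have "h x = h z"
      by (rule cancel)
    \<comment> \<open>Both neighbours of \<open>y\<close> lie on one side, where \<open>h\<close>
      agrees with the injection \<open>f\<close> or \<open>g\<close>.\<close>
    have "x \<in> U \<and> z \<in> U \<or> x \<in> V - U \<and> z \<in> V - U"
      using that(1,2) assms(3) by auto
    then show False
      using inj_onD[OF f(1), of x z] inj_onD[OF g(1), of x z] \<open>h x = h z\<close> \<open>x \<noteq> z\<close>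
      by (auto simp: h_def)
  qed
  have "proper_connected (card V) ?G c"
    unfolding proper_connected_def
  proof (intro ballI impI)
    fix x y assume "x \<in> verts ?G" "y \<in> verts ?G" "x \<noteq> y"
    then have "connected_by ?G (\<lambda>_. True) (card V) x y"
      using assms by (intro complete_bipartite_connected) auto
    then show "connected_by ?G (proper_path c) (card V) x y"
      by (rule connected_by_mono)
        (metis is_path_def proper proper_path_if_proper_edge_coloring)
  qed
  moreover have "c ` edges ?G \<subseteq> {..<?t}"
    using t by (auto simp: c_def)
  ultimately show "\<exists>c. c ` edges ?G \<subseteq> {..<?t} \<and> proper_connected (card V) ?G c"
    by blast
next
  fix n
  assume "\<exists>c. c ` edges (complete_bipartite U V) \<subseteq> {..<n}
    \<and> proper_connected (card V) (complete_bipartite U V) c"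
  then obtain c where c: "c ` edges (complete_bipartite U V) \<subseteq> {..<n}"
    "proper_connected (card V) (complete_bipartite U V) c"
    by blast
  \<comment> \<open>A single vertex of \<open>V\<close> suffices for the lower bound: its
    \<open>card U\<close> edges need distinct colours.\<close>
  obtain v where v: "v \<in> V"
    using assms(4) by blast
  have "inj_on (\<lambda>u. c {u, v}) U"
    using assms(2,3) c(2) v by (rule proper_connected_complete_bipartite_inj)
  moreover have "(\<lambda>u. c {u, v}) ` U \<subseteq> {..<n}"
  proof (rule image_subsetI)
    fix u assume "u \<in> U"
    then have "{u, v} \<in> edges (complete_bipartite U V)"
      using v by simp
    then show "c {u, v} \<in> {..<n}"
      using c(1) by blast
  qed
  ultimately show "card U \<le> n"
    using card_inj_on_le[of _ U "{..<n}"] by simp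
qed

section \<open>The number of vertex colours\<close>

lemma proper_vertex_connected_complete_bipartite_two_colors:
  assumes "U \<inter> V = {}" "u \<in> U" "v \<in> V" "2 \<le> k"
    and conn: "proper_vertex_connected k (complete_bipartite U V) c"
  shows "\<exists>x\<in>U. \<exists>y\<in>V. c x \<noteq> c y"
proof -
  let ?G = "complete_bipartite U V"
  have "u \<noteq> v" using assms by blast
  then obtain P where P: "finite P" "card P = k"
    "\<And>p. p \<in> P \<Longrightarrow> is_path ?G u p v \<and> vertex_proper_path c p"
    using conn assms(2,3) unfolding proper_vertex_connected_def connected_by_def
    by (metis UnI1 UnI2 verts_complete_bipartite)
  \<comment> \<open>At most one of the at least two distinct paths is the bare edge.\<close>
  have "\<not> P \<subseteq> {[u, v]}"
    using P(2) assms(4) card_mono[of "{[u, v]}" P] by auto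
  then obtain p where p: "p \<in> P" "p \<noteq> [u, v]"
    by blast
  then have path: "is_path ?G u p v" and proper: "vertex_proper_path c p"
    using P(3) by blast+
  obtain x q where q: "p = u # x # q" "x \<in> V"
    using path \<open>u \<noteq> v\<close> assms(1,2)
    by (cases p rule: path_edges.cases) (auto simp: is_path_def)
  then obtain y q' where q': "q = y # q'" "y \<in> U"
    using path p(2) assms(1) by (cases q) (auto simp: is_path_def)
  \<comment> \<open>The path ends at \<open>v\<close> in \<open>V\<close>, so it cannot stop at
    \<open>y\<close> in \<open>U\<close>; hence \<open>x\<close> and \<open>y\<close> are adjacent
    inner vertices.\<close>
  then have "q' \<noteq> []"
    using path q assms(1,3) by (auto simp: is_path_def)
  then have "c x \<noteq> c y"
    using proper q q' by (simp add: vertex_proper_path_def inner_verts_def)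
  with q(2) q'(2) show ?thesis
    by metis
qed

lemma pvc_complete_bipartite:
  assumes "finite U" "finite V" "U \<inter> V = {}" "2 \<le> card V" "card V \<le> card U"
  shows "pvc (card V) (complete_bipartite U V) = 2"
  unfolding pvc_def
proof (rule Least_equality)
  let ?G = "complete_bipartite U V"
  define c :: "'a \<Rightarrow> nat" where "c x = (if x \<in> U then 0 else 1)" for x
  have proper: "c x \<noteq> c y" if "{x, y} \<in> edges ?G" for x y
    using that assms(3) by (auto simp: c_def)
  have "proper_vertex_connected (card V) ?G c"
    unfolding proper_vertex_connected_def
  proof (intro ballI impI)
    fix x y assume "x \<in> verts ?G" "y \<in> verts ?G" "x \<noteq> y"
    then have "connected_by ?G (\<lambda>_. True) (card V) x y"
      using assms by (intro complete_bipartite_connected) auto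
    then show "connected_by ?G (vertex_proper_path c) (card V) x y"
      by (rule connected_by_mono)
        (metis is_path_def proper vertex_proper_path_if_proper_coloring)
  qed
  moreover have "c ` verts ?G \<subseteq> {..<2}"
    by (auto simp: c_def)
  ultimately show "\<exists>c. c ` verts ?G \<subseteq> {..<2} \<and> proper_vertex_connected (card V) ?G c"
    by blast
next
  fix n
  assume "\<exists>c. c ` verts (complete_bipartite U V) \<subseteq> {..<n}
    \<and> proper_vertex_connected (card V) (complete_bipartite U V) c"
  then obtain c where c: "c ` (U \<union> V) \<subseteq> {..<n}"
    "proper_vertex_connected (card V) (complete_bipartite U V) c"
    by auto
  have "U \<noteq> {}" "V \<noteq> {}"
    using assms(4,5) by auto
  then obtain u v where "u \<in> U" "v \<in> V"
    by blast
  then obtain x y where "x \<in> U" "y \<in> V" "c x \<noteq> c y"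
    using proper_vertex_connected_complete_bipartite_two_colors[OF assms(3) _ _ assms(4) c(2)]
    by blast
  moreover from this have "c x < n" "c y < n"
    using c(1) by auto
  ultimately show "2 \<le> n"
    by linarith
qed

theorem theorem5:
  fixes k t :: nat and U V :: "'a set"
  assumes "2 \<le> k" and "k < t"
    and "finite U" and "card U = t"
    and "finite V" and "card V = k"
    and "U \<inter> V = {}"
  shows "pc k (complete_bipartite U V) = t \<and> pvc k (complete_bipartite U V) = 2"
proof -
  have "V \<noteq> {}"
    using assms by auto
  then show ?thesis
    using assms pc_complete_bipartite[of U V] pvc_complete_bipartite[of U V] by simp
qed

end
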